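(* Let $V_h$, $A$, $\delta$, $\alpha$, $\psi$, $D = A-\delta I$ and $B_n$ be as in the context, and let $\overline{w}_1\in V_h$ be given. Let $\sigma>0.25$. Then the three-level scheme $$B_n\frac{w_{n+1}-w_{n-1}}{2\tau}+D\big(\sigma w_{n+1}+(1-2\sigma)w_n+\sigma w_{n-1}\big)=0,\quad n=1,2,\dots,N-1,$$ $$w_0=\delta^{-\alpha}\psi,\qquad w_1=\overline{w}_1,$$ is unconditionally stable with respect to the initial data: for every integer $N \ge 2$, with $\tau=1/N$, the approximate solution satisfies $$\mathcal{E}_{n+1}\le \mathcal{E}_n,\quad n=1,2,\dots,N-1,$$ where $$\mathcal{E}_n=\frac14\|w_n+w_{n-1}\|_D^2+\Big(\sigma-\frac14\Big)\|w_n-w_{n-1}\|_D^2 .$$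
   Context: Let $\Omega\subset\mathbb{R}^d$, $d=2,3$, be a bounded domain with Lipschitz continuous boundary, and let $(u,v)=\int_\Omega uv\,d\bm{x}$, $\|u\|=(u,u)^{1/2}$ be the inner product and norm of $L_2(\Omega)$. Let $V_h\subset H^1(\Omega)$ be a (finite-dimensional) finite element space with the inner product and norm of $L_2(\Omega)$. Let $$a(u,v)=\int_\Omega \big(k\,\mathrm{grad}\,u\cdot \mathrm{grad}\,v + c\,uv\big)d\bm{x}+\int_{\partial\Omega}\mu\,uv\,d\bm{x},$$ where $0<k_1\le k(\bm{x})\le k_2$, $c(\bm{x})\ge c_0>0$ and $\mu(\bm{x})\ge 0$. The discrete elliptic operator $A:V_h\to V_h$ is defined by $(Au,v)=a(u,v)$ for all $u,v\in V_h$. It is assumed that $\delta>0$ is a constant such that $A=A^*>\delta I$, i.e. $A$ is self-adjoint and $(Au,u)>\delta\|u\|^2$ for all nonzero $u\in V_h$. Here $I$ is the identity operator. Put $D=A-\delta I$, so $D=D^*>0$. Let $0<\alpha<1$ and $\psi\in V_h$. Time grid: $N\tau=1$, $t_n=n\tau$, and $w_n\in V_h$ denotes the approximation at time $t_n$, $n=0,1,\dots,N$. The operator $B(t)=\frac1\alpha(tD+\delta I)$ and $B_n=B(t_n)$. For a self-adjoint positive operator $S$, $\|y\|_S=(Sy,y)^{1/2}$. *)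

theory Defs
  imports "HOL-Analysis.Analysis"
begin

section \<open>Square-integrable functions\<close>

text \<open>
  Elements of \<open>L\<^sub>2\<close> and \<open>H\<^sup>1\<close> are represented by functions; nothing below depends on the
  representative chosen within an almost-everywhere class.
\<close>

definition L2 :: "'a measure \<Rightarrow> ('a \<Rightarrow> real) set" where
  "L2 M = {f \<in> borel_measurable M. integrable M (\<lambda>x. (f x)\<^sup>2)}"

definition L2_inner :: "'a measure \<Rightarrow> ('a \<Rightarrow> real) \<Rightarrow> ('a \<Rightarrow> real) \<Rightarrow> real" where
  "L2_inner M u v = (\<integral>x. u x * v x \<partial>M)"

definition L2_norm :: "'a measure \<Rightarrow> ('a \<Rightarrow> real) \<Rightarrow> real" where
  "L2_norm M u = sqrt (L2_inner M u u)"

section \<open>Smooth functions and weak gradients\<close>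

definition partial_deriv :: "'n \<Rightarrow> (real^'n \<Rightarrow> real) \<Rightarrow> real^'n \<Rightarrow> real" where
  "partial_deriv i f x = frechet_derivative f (at x) (axis i 1)"

primrec continuously_differentiable :: "nat \<Rightarrow> (real^'n \<Rightarrow> real) \<Rightarrow> bool" where
  "continuously_differentiable 0 f \<longleftrightarrow> continuous_on UNIV f"
| "continuously_differentiable (Suc m) f \<longleftrightarrow>
     (\<forall>x. f differentiable (at x)) \<and> (\<forall>i. continuously_differentiable m (partial_deriv i f))"

definition smooth :: "(real^'n \<Rightarrow> real) \<Rightarrow> bool" where
  "smooth f \<longleftrightarrow> (\<forall>m. continuously_differentiable m f)"

definition test_function :: "(real^'n) set \<Rightarrow> (real^'n \<Rightarrow> real) \<Rightarrow> bool" where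
  "test_function \<Omega> \<phi> \<longleftrightarrow> smooth \<phi> \<and> compact (closure {x. \<phi> x \<noteq> 0}) \<and> closure {x. \<phi> x \<noteq> 0} \<subseteq> \<Omega>"

definition has_weak_gradient ::
    "(real^'n) set \<Rightarrow> (real^'n \<Rightarrow> real) \<Rightarrow> (real^'n \<Rightarrow> real^'n) \<Rightarrow> bool" where
  "has_weak_gradient \<Omega> u G \<longleftrightarrow>
     (\<forall>i. (\<lambda>x. G x $ i) \<in> L2 (lebesgue_on \<Omega>)) \<and>
     (\<forall>\<phi>. test_function \<Omega> \<phi> \<longrightarrow>
        (\<forall>i. (\<integral>x. u x * partial_deriv i \<phi> x \<partial>lebesgue_on \<Omega>) =
             - (\<integral>x. G x $ i * \<phi> x \<partial>lebesgue_on \<Omega>)))"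

definition H1 :: "(real^'n) set \<Rightarrow> (real^'n \<Rightarrow> real) set" where
  "H1 \<Omega> = {u \<in> L2 (lebesgue_on \<Omega>). \<exists>G. has_weak_gradient \<Omega> u G}"

text \<open>The weak gradient is unique up to almost-everywhere equality on \<open>\<Omega>\<close>.\<close>

definition grad :: "(real^'n) set \<Rightarrow> (real^'n \<Rightarrow> real) \<Rightarrow> real^'n \<Rightarrow> real^'n" where
  "grad \<Omega> u = (SOME G. has_weak_gradient \<Omega> u G)"

section \<open>Lipschitz domains, surface measure and traces\<close>

text \<open>
  Near each boundary point the domain is the part of a ball lying strictly above the graph, in some
  direction \<open>e\<close>, of a Lipschitz function on the hyperplane orthogonal to \<open>e\<close>.
\<close>

definition lipschitz_boundary :: "(real^'n) set \<Rightarrow> bool" where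
  "lipschitz_boundary \<Omega> \<longleftrightarrow>
     (\<forall>p \<in> frontier \<Omega>. \<exists>r > 0. \<exists>e L \<gamma>. norm e = 1 \<and> L-lipschitz_on {y. y \<bullet> e = 0} \<gamma> \<and>
        \<Omega> \<inter> ball p r = {x \<in> ball p r. \<gamma> (x - (x \<bullet> e) *\<^sub>R e) < x \<bullet> e})"

definition bounded_lipschitz_domain :: "(real^'n) set \<Rightarrow> bool" where
  "bounded_lipschitz_domain \<Omega> \<longleftrightarrow>
     \<Omega> \<noteq> {} \<and> open \<Omega> \<and> connected \<Omega> \<and> bounded \<Omega> \<and> lipschitz_boundary \<Omega>"

text \<open>
  Hausdorff measure, normalised so that the \<open>s\<close>-dimensional measure of an \<open>s\<close>-dimensional surface
  is its area.  It is used for \<open>s > 0\<close> only; for \<open>s = 0\<close> the convention \<open>0 ^ 0 = 1\<close> would count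
  empty covering sets.  The set function below is a metric outer measure, hence countably additive
  on the Borel sets by Caratheodory's criterion, so \<open>measure_of\<close> does yield a measure with these
  values.
\<close>

definition hausdorff_content :: "nat \<Rightarrow> real \<Rightarrow> 'a::metric_space set \<Rightarrow> ennreal" where
  "hausdorff_content s \<epsilon> X =
     (INF U \<in> {U :: nat \<Rightarrow> 'a set. X \<subseteq> (\<Union>i. U i) \<and> (\<forall>i. bounded (U i) \<and> diameter (U i) \<le> \<epsilon>)}.
        \<Sum>i. ennreal (unit_ball_vol (real s) * (diameter (U i) / 2) ^ s))"

definition hausdorff_measure :: "nat \<Rightarrow> 'a::metric_space measure" where
  "hausdorff_measure s =
     measure_of UNIV (sets borel) (\<lambda>X. SUP \<epsilon> \<in> {0<..}. hausdorff_content s \<epsilon> X)"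

definition boundary_measure :: "(real^'n) set \<Rightarrow> (real^'n) measure" where
  "boundary_measure \<Omega> =
     completion (restrict_space (hausdorff_measure (CARD('n) - 1)) (frontier \<Omega>))"

text \<open>
  The trace extends restriction to the boundary by continuity from smooth functions to \<open>H\<^sup>1\<close>.
  On a bounded Lipschitz domain every element of \<open>H\<^sup>1\<close> has a trace, and it is unique up to
  almost-everywhere equality on the boundary.
\<close>

definition has_trace :: "(real^'n) set \<Rightarrow> (real^'n \<Rightarrow> real) \<Rightarrow> (real^'n \<Rightarrow> real) \<Rightarrow> bool" where
  "has_trace \<Omega> u g \<longleftrightarrow> g \<in> L2 (boundary_measure \<Omega>) \<and>
     (\<exists>\<phi> :: nat \<Rightarrow> real^'n \<Rightarrow> real. (\<forall>j. smooth (\<phi> j)) \<and>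
        (\<lambda>j. L2_norm (lebesgue_on \<Omega>) (\<lambda>x. \<phi> j x - u x)) \<longlonglongrightarrow> 0 \<and>
        (\<forall>i. (\<lambda>j. L2_norm (lebesgue_on \<Omega>) (\<lambda>x. partial_deriv i (\<phi> j) x - grad \<Omega> u x $ i)) \<longlonglongrightarrow> 0) \<and>
        (\<lambda>j. L2_norm (boundary_measure \<Omega>) (\<lambda>x. \<phi> j x - g x)) \<longlonglongrightarrow> 0)"

definition trace_on :: "(real^'n) set \<Rightarrow> (real^'n \<Rightarrow> real) \<Rightarrow> real^'n \<Rightarrow> real" where
  "trace_on \<Omega> u = (SOME g. has_trace \<Omega> u g)"

section \<open>Finite element space and discrete elliptic operator\<close>

text \<open>
  A finite-dimensional subspace of \<open>H\<^sup>1\<close>, given by representatives of its elements: it is spanned by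
  functions that are linearly independent modulo almost-everywhere equality on \<open>\<Omega>\<close>.  Hence two
  members agreeing almost everywhere on \<open>\<Omega>\<close> are the same function, and equality in the space is
  equality of functions.
\<close>

definition finite_element_space :: "(real^'n) set \<Rightarrow> (real^'n \<Rightarrow> real) set \<Rightarrow> bool" where
  "finite_element_space \<Omega> V \<longleftrightarrow>
     (\<exists>(m::nat) \<phi>. (\<forall>i<m. \<phi> i \<in> H1 \<Omega>) \<and>
        (\<forall>a::nat \<Rightarrow> real. (AE x in lebesgue_on \<Omega>. (\<Sum>i<m. a i * \<phi> i x) = 0) \<longrightarrow> (\<forall>i<m. a i = 0)) \<and>
        V = {u. \<exists>a::nat \<Rightarrow> real. u = (\<lambda>x. \<Sum>i<m. a i * \<phi> i x)})"

definition elliptic_form ::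
    "(real^'n) set \<Rightarrow> (real^'n \<Rightarrow> real) \<Rightarrow> (real^'n \<Rightarrow> real) \<Rightarrow> (real^'n \<Rightarrow> real) \<Rightarrow>
     (real^'n \<Rightarrow> real) \<Rightarrow> (real^'n \<Rightarrow> real) \<Rightarrow> real" where
  "elliptic_form \<Omega> k c \<mu> u v =
     (\<integral>x. k x * (grad \<Omega> u x \<bullet> grad \<Omega> v x) + c x * u x * v x \<partial>lebesgue_on \<Omega>) +
     (\<integral>x. \<mu> x * trace_on \<Omega> u x * trace_on \<Omega> v x \<partial>boundary_measure \<Omega>)"

text \<open>
  The last two conjuncts say that the integrals in the bilinear form exist on \<open>V\<close>; they hold
  automatically for bounded \<open>c\<close> and \<open>\<mu>\<close>.
\<close>

definition elliptic_coefficients ::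
    "(real^'n) set \<Rightarrow> (real^'n \<Rightarrow> real) set \<Rightarrow> real \<Rightarrow> real \<Rightarrow> real \<Rightarrow>
     (real^'n \<Rightarrow> real) \<Rightarrow> (real^'n \<Rightarrow> real) \<Rightarrow> (real^'n \<Rightarrow> real) \<Rightarrow> bool" where
  "elliptic_coefficients \<Omega> V k1 k2 c0 k c \<mu> \<longleftrightarrow>
     k \<in> borel_measurable (lebesgue_on \<Omega>) \<and>
     c \<in> borel_measurable (lebesgue_on \<Omega>) \<and>
     \<mu> \<in> borel_measurable (boundary_measure \<Omega>) \<and>
     0 < k1 \<and> (\<forall>x \<in> \<Omega>. k1 \<le> k x \<and> k x \<le> k2) \<and>
     0 < c0 \<and> (\<forall>x \<in> \<Omega>. c0 \<le> c x) \<and>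
     (\<forall>x \<in> frontier \<Omega>. 0 \<le> \<mu> x) \<and>
     (\<forall>u \<in> V. \<forall>v \<in> V. integrable (lebesgue_on \<Omega>) (\<lambda>x. c x * u x * v x)) \<and>
     (\<forall>u \<in> V. \<forall>v \<in> V.
        integrable (boundary_measure \<Omega>) (\<lambda>x. \<mu> x * trace_on \<Omega> u x * trace_on \<Omega> v x))"

type_synonym 'n operator = "(real^'n \<Rightarrow> real) \<Rightarrow> (real^'n \<Rightarrow> real)"

definition discrete_elliptic_operator ::
    "(real^'n) set \<Rightarrow> (real^'n \<Rightarrow> real) set \<Rightarrow>
     (real^'n \<Rightarrow> real) \<Rightarrow> (real^'n \<Rightarrow> real) \<Rightarrow> (real^'n \<Rightarrow> real) \<Rightarrow> 'n operator \<Rightarrow> bool" where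
  "discrete_elliptic_operator \<Omega> V k c \<mu> A \<longleftrightarrow>
     (\<forall>u \<in> V. A u \<in> V \<and> (\<forall>v \<in> V. L2_inner (lebesgue_on \<Omega>) (A u) v = elliptic_form \<Omega> k c \<mu> u v))"

definition self_adjoint_on :: "(real^'n) set \<Rightarrow> (real^'n \<Rightarrow> real) set \<Rightarrow> 'n operator \<Rightarrow> bool" where
  "self_adjoint_on \<Omega> V S \<longleftrightarrow>
     (\<forall>u \<in> V. \<forall>v \<in> V. L2_inner (lebesgue_on \<Omega>) (S u) v = L2_inner (lebesgue_on \<Omega>) u (S v))"

definition bounded_below_by ::
    "(real^'n) set \<Rightarrow> (real^'n \<Rightarrow> real) set \<Rightarrow> real \<Rightarrow> 'n operator \<Rightarrow> bool" where
  "bounded_below_by \<Omega> V \<delta> S \<longleftrightarrow>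
     (\<forall>u \<in> V. u \<noteq> (\<lambda>x. 0) \<longrightarrow>
        L2_inner (lebesgue_on \<Omega>) (S u) u > \<delta> * (L2_norm (lebesgue_on \<Omega>) u)\<^sup>2)"

definition operator_norm :: "(real^'n) set \<Rightarrow> 'n operator \<Rightarrow> (real^'n \<Rightarrow> real) \<Rightarrow> real" where
  "operator_norm \<Omega> S y = sqrt (L2_inner (lebesgue_on \<Omega>) (S y) y)"

section \<open>The three-level scheme\<close>

definition D_op :: "'n operator \<Rightarrow> real \<Rightarrow> 'n operator" where
  "D_op A \<delta> u = (\<lambda>x. A u x - \<delta> * u x)"

definition B_op :: "'n operator \<Rightarrow> real \<Rightarrow> real \<Rightarrow> real \<Rightarrow> 'n operator" where
  "B_op A \<delta> \<alpha> t u = (\<lambda>x. 1 / \<alpha> * (t * D_op A \<delta> u x + \<delta> * u x))"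

definition three_level_solution ::
    "(real^'n \<Rightarrow> real) set \<Rightarrow> 'n operator \<Rightarrow> real \<Rightarrow> real \<Rightarrow> real \<Rightarrow>
     (real^'n \<Rightarrow> real) \<Rightarrow> (real^'n \<Rightarrow> real) \<Rightarrow> nat \<Rightarrow> real \<Rightarrow> (nat \<Rightarrow> real^'n \<Rightarrow> real) \<Rightarrow> bool" where
  "three_level_solution V A \<delta> \<alpha> \<sigma> \<psi> w1 N \<tau> w \<longleftrightarrow>
     (\<forall>n \<le> N. w n \<in> V) \<and>
     w 0 = (\<lambda>x. \<delta> powr (- \<alpha>) * \<psi> x) \<and>
     w 1 = w1 \<and>
     (\<forall>n \<in> {1..N - 1}. \<forall>x.
        B_op A \<delta> \<alpha> (real n * \<tau>) (\<lambda>y. (w (n + 1) y - w (n - 1) y) / (2 * \<tau>)) x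
        + D_op A \<delta> (\<lambda>y. \<sigma> * w (n + 1) y + (1 - 2 * \<sigma>) * w n y + \<sigma> * w (n - 1) y) x = 0)"

definition energy ::
    "(real^'n) set \<Rightarrow> 'n operator \<Rightarrow> real \<Rightarrow> real \<Rightarrow> (nat \<Rightarrow> real^'n \<Rightarrow> real) \<Rightarrow> nat \<Rightarrow> real" where
  "energy \<Omega> A \<delta> \<sigma> w n =
     1 / 4 * (operator_norm \<Omega> (D_op A \<delta>) (\<lambda>x. w n x + w (n - 1) x))\<^sup>2
     + (\<sigma> - 1 / 4) * (operator_norm \<Omega> (D_op A \<delta>) (\<lambda>x. w n x - w (n - 1) x))\<^sup>2"

end

theory Submission
  imports Defs
begin

text \<open>
  The energy estimate comes from pairing the scheme with the central difference
  \<open>d = w\<^sub>n\<^sub>+\<^sub>1 - w\<^sub>n\<^sub>-\<^sub>1\<close> in \<open>L\<^sub>2\<close>.  Write \<open>b(u, v) = (D u, v)\<close>.  The weighted average satisfies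
  \<open>\<sigma> w\<^sub>n\<^sub>+\<^sub>1 + (1 - 2\<sigma>) w\<^sub>n + \<sigma> w\<^sub>n\<^sub>-\<^sub>1 = w\<^sub>n + \<sigma> (w\<^sub>n\<^sub>+\<^sub>1 - 2 w\<^sub>n + w\<^sub>n\<^sub>-\<^sub>1)\<close>,
  so bilinearity and symmetry of \<open>b\<close> turn its pairing with \<open>d\<close> into exactly the energy
  increment (\<open>energy_increment\<close>).  With \<open>r = d / (2\<tau>)\<close>, the scheme says that this increment
  equals \<open>- (B\<^sub>n r, d) = - 2\<tau> (B\<^sub>n r, r)\<close>, and \<open>B\<^sub>n\<close> is a nonnegative combination of the
  nonnegative operators \<open>D\<close> and \<open>I\<close>; hence the energy cannot grow
  (\<open>inner_average_nonpositive\<close>).  Every step is an exact identity or a sign, so the size of \<open>\<tau>\<close>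
  never has to be weighed against a bound for \<open>D\<close>: this is why the stability is unconditional.

  The bilinearity of \<open>b\<close> comes from the integral and from symmetry: linearity in the second
  argument is linearity of the integral, and \<open>(D u, v) = (u, D v)\<close> transports it to the first.
\<close>

lemma L2_mult_integrable:
  assumes "f \<in> L2 M" "g \<in> L2 M"
  shows "integrable M (\<lambda>x. f x * g x)"
proof (rule Bochner_Integration.integrable_bound)
  show "integrable M (\<lambda>x. (f x)\<^sup>2 + (g x)\<^sup>2)"
    using assms by (simp add: L2_def)
  show "(\<lambda>x. f x * g x) \<in> borel_measurable M"
    using assms by (auto simp: L2_def)
  have "\<bar>f x * g x\<bar> \<le> (f x)\<^sup>2 + (g x)\<^sup>2" for x
  proof -
    have "2 * (\<bar>f x\<bar> * \<bar>g x\<bar>) \<le> (f x)\<^sup>2 + (g x)\<^sup>2"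
      using sum_squares_bound[of "\<bar>f x\<bar>" "\<bar>g x\<bar>"] by (simp add: mult.assoc)
    moreover have "0 \<le> \<bar>f x\<bar> * \<bar>g x\<bar>"
      by simp
    ultimately show ?thesis
      unfolding abs_mult by linarith
  qed
  then show "AE x in M. norm (f x * g x) \<le> norm ((f x)\<^sup>2 + (g x)\<^sup>2)"
    by simp
qed

lemma L2_linear_combination:
  assumes "f \<in> L2 M" "g \<in> L2 M"
  shows "(\<lambda>x. a * f x + b * g x) \<in> L2 M"
proof -
  have "integrable M (\<lambda>x. a\<^sup>2 * (f x)\<^sup>2 + 2 * a * b * (f x * g x) + b\<^sup>2 * (g x)\<^sup>2)"
    using assms L2_mult_integrable[OF assms] by (auto simp: L2_def)
  also have "(\<lambda>x. a\<^sup>2 * (f x)\<^sup>2 + 2 * a * b * (f x * g x) + b\<^sup>2 * (g x)\<^sup>2)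
      = (\<lambda>x. (a * f x + b * g x)\<^sup>2)"
    by (simp add: fun_eq_iff power2_eq_square algebra_simps)
  finally show ?thesis
    using assms by (auto simp: L2_def)
qed

lemma L2_sum:
  fixes m :: nat
  assumes "\<And>i. i < m \<Longrightarrow> f i \<in> L2 M"
  shows "(\<lambda>x. \<Sum>i<m. a i * f i x) \<in> L2 M"
  using assms
proof (induction m)
  case 0
  then show ?case
    by (simp add: L2_def)
next
  case (Suc m)
  then show ?case
    using L2_linear_combination[of "\<lambda>x. \<Sum>i<m. a i * f i x" M "f m" 1 "a m"] by simp
qed

lemma finite_element_space_subset_L2:
  assumes "finite_element_space \<Omega> V" "u \<in> V"
  shows "u \<in> L2 (lebesgue_on \<Omega>)"
  using assms unfolding finite_element_space_def H1_def by (auto intro!: L2_sum)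

lemma finite_element_space_linear_combination:
  assumes V: "finite_element_space \<Omega> V" and uv: "u \<in> V" "v \<in> V"
  shows "(\<lambda>x. a * u x + b * v x) \<in> V"
proof -
  obtain m :: nat and \<phi> where V_eq: "V = {u. \<exists>a::nat \<Rightarrow> real. u = (\<lambda>x. \<Sum>i<m. a i * \<phi> i x)}"
    using V unfolding finite_element_space_def by blast
  obtain p q where pq: "u = (\<lambda>x. \<Sum>i<m. p i * \<phi> i x)" "v = (\<lambda>x. \<Sum>i<m. q i * \<phi> i x)"
    using uv unfolding V_eq by blast
  have "(\<lambda>x. a * u x + b * v x) = (\<lambda>x. \<Sum>i<m. (a * p i + b * q i) * \<phi> i x)"
    unfolding pq by (simp add: sum_distrib_left sum.distrib algebra_simps)
  then show ?thesis
    unfolding V_eq mem_Collect_eq by (rule exI[of _ "\<lambda>i. a * p i + b * q i"])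
qed

text \<open>
  This is the setting of the energy argument; the elliptic problem supplies an instance through
  \<open>D = A - \<delta> I\<close>.  Square integrability makes the inner products exist, so that the integral can
  be split along linear combinations.
\<close>

locale nonnegative_symmetric_operator =
  fixes M :: "'a measure" and V :: "('a \<Rightarrow> real) set" and D :: "('a \<Rightarrow> real) \<Rightarrow> 'a \<Rightarrow> real"
  assumes square_integrable: "u \<in> V \<Longrightarrow> u \<in> L2 M"
    and linear_combination: "u \<in> V \<Longrightarrow> v \<in> V \<Longrightarrow> (\<lambda>x. a * u x + b * v x) \<in> V"
    and maps_to: "u \<in> V \<Longrightarrow> D u \<in> V"
    and symmetric: "u \<in> V \<Longrightarrow> v \<in> V \<Longrightarrow> L2_inner M (D u) v = L2_inner M u (D v)"
    and nonnegative: "u \<in> V \<Longrightarrow> 0 \<le> L2_inner M (D u) u"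
begin

lemma linear_combination3:
  assumes "p \<in> V" "q \<in> V" "r \<in> V"
  shows "(\<lambda>x. a * p x + b * q x + c * r x) \<in> V"
  using linear_combination[OF linear_combination[OF assms(1,2), of a b] assms(3), of 1 c] by simp

lemma inner_linear_combination_left:
  assumes "p \<in> V" "q \<in> V" "r \<in> V" "v \<in> V"
  shows "L2_inner M (\<lambda>x. a * p x + b * q x + c * r x) v
    = a * L2_inner M p v + b * L2_inner M q v + c * L2_inner M r v"
proof -
  have int: "integrable M (\<lambda>x. f x * v x)" if "f \<in> V" for f
    using that assms by (intro L2_mult_integrable square_integrable)
  have "L2_inner M (\<lambda>x. a * p x + b * q x + c * r x) v
      = (\<integral>x. a * (p x * v x) + b * (q x * v x) + c * (r x * v x) \<partial>M)"
    unfolding L2_inner_def by (simp add: algebra_simps)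
  also have "\<dots> = a * L2_inner M p v + b * L2_inner M q v + c * L2_inner M r v"
    using int assms by (simp add: L2_inner_def)
  finally show ?thesis .
qed

lemma inner_commute: "L2_inner M u v = L2_inner M v u"
  by (simp add: L2_inner_def mult.commute)

text \<open>
  Moving \<open>D\<close> to the other argument by symmetry exposes the linear combination, which the integral
  can then split.
\<close>

lemma form_linear_combination_left:
  assumes "p \<in> V" "q \<in> V" "r \<in> V" "v \<in> V"
  shows "L2_inner M (D (\<lambda>x. a * p x + b * q x + c * r x)) v
    = a * L2_inner M (D p) v + b * L2_inner M (D q) v + c * L2_inner M (D r) v"
  using assms by (simp add: symmetric linear_combination3 inner_linear_combination_left maps_to)

lemma form_commute:
  assumes "u \<in> V" "v \<in> V"
  shows "L2_inner M (D u) v = L2_inner M (D v) u"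
  using symmetric[OF assms] inner_commute by simp

lemma form_linear_combination_right:
  assumes "p \<in> V" "q \<in> V" "r \<in> V" "v \<in> V"
  shows "L2_inner M (D v) (\<lambda>x. a * p x + b * q x + c * r x)
    = a * L2_inner M (D v) p + b * L2_inner M (D v) q + c * L2_inner M (D v) r"
  using assms by (simp add: inner_commute[of "D v"] inner_linear_combination_left maps_to)

text \<open>
  Polarisation: the difference of squares \<open>b(p + v, p + v) - b(v + q, v + q)\<close> equals
  \<open>b(p + 2v + q, p - q)\<close>, and that of \<open>b(p - v, p - v) - b(v - q, v - q)\<close> equals
  \<open>b(p - 2v + q, p - q)\<close>.  With the weights \<open>1/4\<close> and \<open>\<sigma> - 1/4\<close> the first arguments add up to
  \<open>v + \<sigma> (p - 2v + q)\<close>, the average used by the scheme.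
\<close>

lemma energy_increment:
  fixes \<sigma> :: real
  assumes V: "p \<in> V" "v \<in> V" "q \<in> V"
  shows "L2_inner M (D (\<lambda>x. \<sigma> * p x + (1 - 2 * \<sigma>) * v x + \<sigma> * q x)) (\<lambda>x. p x - q x)
    = (1 / 4 * L2_inner M (D (\<lambda>x. p x + v x)) (\<lambda>x. p x + v x)
        + (\<sigma> - 1 / 4) * L2_inner M (D (\<lambda>x. p x - v x)) (\<lambda>x. p x - v x))
    - (1 / 4 * L2_inner M (D (\<lambda>x. v x + q x)) (\<lambda>x. v x + q x)
        + (\<sigma> - 1 / 4) * L2_inner M (D (\<lambda>x. v x - q x)) (\<lambda>x. v x - q x))"
proof -
  (* All five inner products in the claim are instances of one Gram expansion in p, v, q. *)
  have form: "L2_inner M (D (\<lambda>x. a * p x + b * v x + c * q x)) (\<lambda>x. a' * p x + b' * v x + c' * q x)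
      = a * a' * L2_inner M (D p) p + b * b' * L2_inner M (D v) v + c * c' * L2_inner M (D q) q
      + (a * b' + b * a') * L2_inner M (D p) v + (a * c' + c * a') * L2_inner M (D p) q
      + (b * c' + c * b') * L2_inner M (D v) q" for a b c a' b' c'
    unfolding form_linear_combination_left[OF V linear_combination3[OF V]]
      form_linear_combination_right[OF V V(1)] form_linear_combination_right[OF V V(2)]
      form_linear_combination_right[OF V V(3)]
      form_commute[OF V(2,1)] form_commute[OF V(3,1)] form_commute[OF V(3,2)]
    by algebra
  have average: "L2_inner M (D (\<lambda>x. \<sigma> * p x + (1 - 2 * \<sigma>) * v x + \<sigma> * q x)) (\<lambda>x. p x - q x)
      = \<sigma> * L2_inner M (D p) p - \<sigma> * L2_inner M (D q) q
        + (1 - 2 * \<sigma>) * L2_inner M (D p) v + (2 * \<sigma> - 1) * L2_inner M (D v) q"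
    using form[of \<sigma> "1 - 2 * \<sigma>" \<sigma> 1 0 "-1"] by simp
  have plus: "L2_inner M (D (\<lambda>x. p x + v x)) (\<lambda>x. p x + v x)
      = L2_inner M (D p) p + L2_inner M (D v) v + 2 * L2_inner M (D p) v"
    "L2_inner M (D (\<lambda>x. v x + q x)) (\<lambda>x. v x + q x)
      = L2_inner M (D v) v + L2_inner M (D q) q + 2 * L2_inner M (D v) q"
    using form[of 1 1 0 1 1 0] form[of 0 1 1 0 1 1] by simp_all
  have minus: "L2_inner M (D (\<lambda>x. p x - v x)) (\<lambda>x. p x - v x)
      = L2_inner M (D p) p + L2_inner M (D v) v - 2 * L2_inner M (D p) v"
    "L2_inner M (D (\<lambda>x. v x - q x)) (\<lambda>x. v x - q x)
      = L2_inner M (D v) v + L2_inner M (D q) q - 2 * L2_inner M (D v) q"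
    using form[of 1 "-1" 0 1 "-1" 0] form[of 0 1 "-1" 0 1 "-1"] by simp_all
  show ?thesis
    unfolding average plus minus by (simp add: field_simps)
qed

text \<open>
  The dissipation step.  Here \<open>a D + b I\<close> is the operator \<open>B\<^sub>n\<close> and \<open>s\<close> is \<open>2\<tau>\<close>.  The scheme replaces
  \<open>D\<close> of the average by \<open>- (a D r + b r)\<close> with \<open>r = (p - q) / s\<close>; since \<open>p - q = s r\<close>, the
  pairing becomes a quadratic form in \<open>r\<close> with a sign.
\<close>

lemma inner_average_nonpositive:
  fixes \<sigma> a b s :: real
  assumes V: "p \<in> V" "v \<in> V" "q \<in> V" and nonneg: "0 \<le> a" "0 \<le> b" "0 < s"
    and scheme: "\<And>x. a * D (\<lambda>y. (p y - q y) / s) x + b * ((p x - q x) / s)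
      + D (\<lambda>y. \<sigma> * p y + (1 - 2 * \<sigma>) * v y + \<sigma> * q y) x = 0"
  shows "L2_inner M (D (\<lambda>x. \<sigma> * p x + (1 - 2 * \<sigma>) * v x + \<sigma> * q x)) (\<lambda>x. p x - q x) \<le> 0"
proof -
  define r where "r = (\<lambda>x. (p x - q x) / s)"
  have r: "r \<in> V"
    using linear_combination[OF V(1,3), of "1 / s" "- (1 / s)"]
    by (simp add: r_def diff_divide_distrib)
  have d: "(\<lambda>x. p x - q x) = (\<lambda>x. s * r x)"
    using nonneg by (simp add: r_def)
  have scale: "L2_inner M u (\<lambda>x. s * r x) = s * L2_inner M u r" for u
    by (simp add: L2_inner_def mult.left_commute)
  (* The zero term brings the right-hand side into the three-term shape of the splitting lemma. *)
  have average: "D (\<lambda>x. \<sigma> * p x + (1 - 2 * \<sigma>) * v x + \<sigma> * q x)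
      = (\<lambda>x. (- a) * D r x + (- b) * r x + 0 * r x)"
    using scheme by (simp add: fun_eq_iff r_def) (smt (verit, best))
  have "L2_inner M (D (\<lambda>x. \<sigma> * p x + (1 - 2 * \<sigma>) * v x + \<sigma> * q x)) (\<lambda>x. p x - q x)
      = - (s * (a * L2_inner M (D r) r + b * L2_inner M r r))"
    unfolding average d scale inner_linear_combination_left[OF maps_to[OF r] r r r]
    by (simp add: algebra_simps)
  moreover have "0 \<le> s * (a * L2_inner M (D r) r + b * L2_inner M r r)"
  proof -
    have "0 \<le> L2_inner M r r"
      by (simp add: L2_inner_def)
    then show ?thesis
      using nonneg nonnegative[OF r] by simp
  qed
  ultimately show ?thesis
    by simp
qed

end

lemma D_op_nonnegative_symmetric:
  assumes V: "finite_element_space \<Omega> V"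
    and A: "discrete_elliptic_operator \<Omega> V k c \<mu> A"
    and self: "self_adjoint_on \<Omega> V A"
    and below: "bounded_below_by \<Omega> V \<delta> A"
  shows "nonnegative_symmetric_operator (lebesgue_on \<Omega>) V (D_op A \<delta>)"
proof
  let ?M = "lebesgue_on \<Omega>"
  have AV: "A u \<in> V" if "u \<in> V" for u
    using A that by (auto simp: discrete_elliptic_operator_def)
  have int: "integrable ?M (\<lambda>x. u x * v x)" if "u \<in> V" "v \<in> V" for u v
    using that V by (auto intro: L2_mult_integrable finite_element_space_subset_L2)
  have inner_D: "L2_inner ?M (D_op A \<delta> u) v = L2_inner ?M (A u) v - \<delta> * L2_inner ?M u v"
    if "u \<in> V" "v \<in> V" for u v
    using int[OF AV[OF that(1)] that(2)] int[OF that]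
    by (simp add: L2_inner_def D_op_def left_diff_distrib mult.assoc)
  fix u v a b
  show "u \<in> L2 ?M" if "u \<in> V"
    using V that by (rule finite_element_space_subset_L2)
  show "(\<lambda>x. a * u x + b * v x) \<in> V" if "u \<in> V" "v \<in> V"
    using V that by (rule finite_element_space_linear_combination)
  show "D_op A \<delta> u \<in> V" if "u \<in> V"
    using finite_element_space_linear_combination[OF V AV[OF that] that, of 1 "- \<delta>"]
    by (simp add: D_op_def[abs_def])
  show "L2_inner ?M (D_op A \<delta> u) v = L2_inner ?M u (D_op A \<delta> v)" if "u \<in> V" "v \<in> V"
  proof -
    have "L2_inner ?M f g = L2_inner ?M g f" for f g
      by (simp add: L2_inner_def mult.commute)
    then show ?thesis
      using self that inner_D[of u v] inner_D[of v u]
      by (simp add: self_adjoint_on_def)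
  qed
  show "0 \<le> L2_inner ?M (D_op A \<delta> u) u" if "u \<in> V"
  proof (cases "u = (\<lambda>x. 0)")
    case True
    then show ?thesis
      by (simp add: L2_inner_def)
  next
    case False
    have "0 \<le> L2_inner ?M u u"
      by (simp add: L2_inner_def)
    then show ?thesis
      using below False that inner_D[OF that that]
      by (auto simp: bounded_below_by_def L2_norm_def)
  qed
qed

theorem theorem2:
  fixes \<Omega> :: "(real^'n) set"
    and V :: "(real^'n \<Rightarrow> real) set"
    and k c \<mu> \<psi> w1 :: "real^'n \<Rightarrow> real"
    and A :: "(real^'n \<Rightarrow> real) \<Rightarrow> (real^'n \<Rightarrow> real)"
    and k1 k2 c0 \<delta> \<alpha> \<sigma> :: real
  assumes "CARD('n) = 2 \<or> CARD('n) = 3"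
    and "bounded_lipschitz_domain \<Omega>"
    and "finite_element_space \<Omega> V"
    and "elliptic_coefficients \<Omega> V k1 k2 c0 k c \<mu>"
    and "discrete_elliptic_operator \<Omega> V k c \<mu> A"
    and "\<delta> > 0"
    and "self_adjoint_on \<Omega> V A"
    and "bounded_below_by \<Omega> V \<delta> A"
    and "0 < \<alpha>" and "\<alpha> < 1"
    and "\<psi> \<in> V" and "w1 \<in> V"
    and "\<sigma> > 1 / 4"
  shows "\<forall>N::nat. N \<ge> 2 \<longrightarrow>
    (\<forall>\<tau> w. \<tau> = 1 / real N \<longrightarrow> three_level_solution V A \<delta> \<alpha> \<sigma> \<psi> w1 N \<tau> w \<longrightarrow>
      (\<forall>n \<in> {1..N - 1}. energy \<Omega> A \<delta> \<sigma> w (n + 1) \<le> energy \<Omega> A \<delta> \<sigma> w n))"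
proof (intro allI impI ballI)
  fix N n :: nat and \<tau> :: real and w
  assume "2 \<le> N" and \<tau>: "\<tau> = 1 / real N"
    and sol: "three_level_solution V A \<delta> \<alpha> \<sigma> \<psi> w1 N \<tau> w" and n: "n \<in> {1..N - 1}"
  let ?M = "lebesgue_on \<Omega>"
  let ?D = "D_op A \<delta>"
  interpret nonnegative_symmetric_operator ?M V ?D
    by (rule D_op_nonnegative_symmetric[OF assms(3,5,7,8)])
  have \<tau>_pos: "0 < \<tau>"
    using \<tau> \<open>2 \<le> N\<close> by simp
  have V: "w (n + 1) \<in> V" "w n \<in> V" "w (n - 1) \<in> V"
    using sol n by (auto simp: three_level_solution_def)
  have scheme: "B_op A \<delta> \<alpha> (real n * \<tau>) (\<lambda>y. (w (n + 1) y - w (n - 1) y) / (2 * \<tau>)) x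
        + ?D (\<lambda>y. \<sigma> * w (n + 1) y + (1 - 2 * \<sigma>) * w n y + \<sigma> * w (n - 1) y) x = 0" for x
    using sol n unfolding three_level_solution_def by blast
  have B_op_split: "B_op A \<delta> \<alpha> t u x = t / \<alpha> * ?D u x + \<delta> / \<alpha> * u x" for t u x
    by (simp add: B_op_def algebra_simps)
  have nonpositive: "L2_inner ?M
      (?D (\<lambda>x. \<sigma> * w (n + 1) x + (1 - 2 * \<sigma>) * w n x + \<sigma> * w (n - 1) x))
      (\<lambda>x. w (n + 1) x - w (n - 1) x) \<le> 0"
  proof (rule inner_average_nonpositive[OF V])
    show "0 \<le> real n * \<tau> / \<alpha>" "0 \<le> \<delta> / \<alpha>" "0 < 2 * \<tau>"
      using \<tau>_pos \<open>0 < \<alpha>\<close> \<open>\<delta> > 0\<close> by auto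
  qed (use scheme in \<open>simp only: B_op_split\<close>)
  have norm: "(operator_norm \<Omega> ?D u)\<^sup>2 = L2_inner ?M (?D u) u" if "u \<in> V" for u
    using nonnegative[OF that] by (simp add: operator_norm_def)
  have combos: "(\<lambda>x. u x + v x) \<in> V" "(\<lambda>x. u x - v x) \<in> V" if "u \<in> V" "v \<in> V" for u v
    using linear_combination[OF that, of 1 1] linear_combination[OF that, of 1 "-1"] by simp_all
  show "energy \<Omega> A \<delta> \<sigma> w (n + 1) \<le> energy \<Omega> A \<delta> \<sigma> w n"
    using nonpositive energy_increment[OF V, of \<sigma>] V by (simp add: energy_def norm combos)
qed

end
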